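(* Let $a,b,c\ge 1$ be integers, let $\Gamma=Y_{a,b,c}$, let $n=a+b+c+1$, and let $B$ be the bilinear form on the associated reflection representation $V$. Then the set $\mathcal{B}=\mathcal{B}(a,b,c)$ is a basis for the submodule $M=\ker B$ of $S^2(V)$.
   Context: $Y_{a,b,c}$ ($a,b,c\ge1$) is the tree with $n=a+b+c+1$ vertices consisting of three paths with $a$, $b$ and $c$ vertices, each joined by one of its endpoints to a common trivalent branch vertex. Its Cartan matrix $A$ has $A_{ii}=2$, $A_{ij}=-1$ if $i,j$ are adjacent, and $A_{ij}=0$ otherwise. $W$ is the group generated by $s_1,\dots,s_n$ subject to $s_i^2=1$, $s_is_j=s_js_i$ if $A_{ij}=0$, and $s_is_js_i=s_js_is_j$ if $A_{ij}=-1$. $V$ is the real vector space with basis the simple roots $\Pi=\{\alpha_1,\dots,\alpha_n\}$, with symmetric bilinear form $B(\alpha_i,\alpha_j)=A_{ij}$, on which $W$ acts by $s_i(v)=v-B(\alpha_i,v)\alpha_i$ (the reflection representation). For $\alpha,\beta\in V$ put $\alpha\vee\beta=\alpha\otimes\beta+\beta\otimes\alpha$. $S^2(V)\subseteq V\otimes V$ is the span of all $\alpha\vee\beta$, with the diagonal action of $W$. Regard $B$ as the linear map $V\otimes V\to\mathbb{R}$, $v\otimes v'\mapsto B(v,v')$, restricted to $S^2(V)$; $M=\ker B\subseteq S^2(V)$. Elementary roots. The highest root of a type $D_m$ ($m\ge4$) root system is the sum of the simple roots with coefficient $1$ at the endpoints of the diagram and $2$ at all other vertices. For a simple root $\alpha_i$,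 a positive root $\beta$ is called elementary with respect to $\alpha_i$ if one of the following holds: (1) $\beta=\alpha_j$ is a simple root with $A_{ij}=0$; (2) $\beta=\alpha_h+\alpha_i+\alpha_j$ for a path $h$--$i$--$j$ in $Y_{a,b,c}$ (with middle vertex $i$); (3) $i$ is not the branch vertex and $\beta=\theta_i$, where $\theta_i$ is the highest root of the standard parabolic subsystem of type $D_m$ ($m\ge 4$) whose simple roots are those on the path from $i$ to the branch vertex together with all neighbours of the branch vertex. $\mathcal{B}(a,b,c)$ is the set of all $\alpha_i\vee\beta\in S^2(V)$ with $\alpha_i\in\Pi$ and $\beta$ elementary with respect to $\alpha_i$. *)

theory Defs
  imports "HOL-Analysis.Linear_Algebra" "HOL-Analysis.Finite_Function_Topology"
begin

section \<open>The tree\<close>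

datatype arm = ArmA | ArmB | ArmC

text \<open>\<open>Arm k l\<close> is the vertex at distance \<open>l + 1\<close> from the branch vertex on the arm \<open>k\<close>.\<close>

datatype vertex = Branch | Arm arm nat

fun arm_length :: "nat \<Rightarrow> nat \<Rightarrow> nat \<Rightarrow> arm \<Rightarrow> nat" where
  "arm_length a b c ArmA = a"
| "arm_length a b c ArmB = b"
| "arm_length a b c ArmC = c"

definition verts :: "nat \<Rightarrow> nat \<Rightarrow> nat \<Rightarrow> vertex set" where
  "verts a b c = insert Branch {Arm k l | k l. l < arm_length a b c k}"

inductive towards :: "vertex \<Rightarrow> vertex \<Rightarrow> bool" where
  "towards (Arm k 0) Branch"
| "towards (Arm k (Suc l)) (Arm k l)"

definition adj :: "nat \<Rightarrow> nat \<Rightarrow> nat \<Rightarrow> vertex \<Rightarrow> vertex \<Rightarrow> bool" where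
  "adj a b c i j \<longleftrightarrow> i \<in> verts a b c \<and> j \<in> verts a b c \<and> (towards i j \<or> towards j i)"

definition cartan :: "nat \<Rightarrow> nat \<Rightarrow> nat \<Rightarrow> vertex \<Rightarrow> vertex \<Rightarrow> real" where
  "cartan a b c i j = (if i = j then 2 else if adj a b c i j then - 1 else 0)"


section \<open>Free vector spaces and tensors in coordinates\<close>

text \<open>
  \<open>'k \<Rightarrow>\<^sub>0 real\<close> is the free real vector space on the type \<open>'k\<close>, and \<open>linext f\<close> is
  the linear map on it that sends the basis vector \<open>k\<close> to \<open>f k\<close>.
\<close>

definition linext :: "('k \<Rightarrow> 'w) \<Rightarrow> ('k \<Rightarrow>\<^sub>0 real) \<Rightarrow> 'w::real_vector" where
  "linext f x = (\<Sum>k\<in>Poly_Mapping.keys x. Poly_Mapping.lookup x k *\<^sub>R f k)"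

text \<open>
  A space with a basis indexed by vertices has a tensor square with a basis indexed by pairs
  of vertices; \<open>Poly_Mapping.single (i, j) 1\<close> stands for
  \<open>\<alpha>\<^sub>i \<otimes> \<alpha>\<^sub>j\<close>.
\<close>

definition tensor :: "('k \<Rightarrow>\<^sub>0 real) \<Rightarrow> ('l \<Rightarrow>\<^sub>0 real) \<Rightarrow> ('k \<times> 'l \<Rightarrow>\<^sub>0 real)" where
  "tensor x y = linext (\<lambda>i. linext (\<lambda>j. Poly_Mapping.single (i, j) 1) y) x"

definition sym_tensor :: "('k \<Rightarrow>\<^sub>0 real) \<Rightarrow> ('k \<Rightarrow>\<^sub>0 real) \<Rightarrow> ('k \<times> 'k \<Rightarrow>\<^sub>0 real)" where
  "sym_tensor x y = tensor x y + tensor y x"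

text \<open>The diagonal map \<open>f \<otimes> f\<close>.\<close>

definition diag :: "(('k \<Rightarrow>\<^sub>0 real) \<Rightarrow> ('k \<Rightarrow>\<^sub>0 real)) \<Rightarrow> ('k \<times> 'k \<Rightarrow>\<^sub>0 real) \<Rightarrow> ('k \<times> 'k \<Rightarrow>\<^sub>0 real)" where
  "diag f = linext (\<lambda>(i, j). tensor (f (Poly_Mapping.single i 1)) (f (Poly_Mapping.single j 1)))"

lemma lookup_scaleR [simp]:
  "Poly_Mapping.lookup (r *\<^sub>R x) k = r *\<^sub>R Poly_Mapping.lookup x k"
proof -
  have "finite {i. r *\<^sub>R Poly_Mapping.lookup x i \<noteq> 0}"
    by (rule finite_subset[of _ "{i. Poly_Mapping.lookup x i \<noteq> 0}"]) auto
  then show ?thesis by (simp add: scaleR_poly_mapping_def)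
qed

lemma linext_superset:
  assumes "finite S" "Poly_Mapping.keys x \<subseteq> S"
  shows "linext f x = (\<Sum>k\<in>S. Poly_Mapping.lookup x k *\<^sub>R f k)"
  unfolding linext_def using assms
  by (intro sum.mono_neutral_left) (auto simp: in_keys_iff)

lemma linear_linext: "linear (linext f)"
proof (rule linearI)
  fix x y :: "'a \<Rightarrow>\<^sub>0 real" and r :: real
  let ?S = "Poly_Mapping.keys x \<union> Poly_Mapping.keys y"
  have "Poly_Mapping.keys (x + y) \<subseteq> ?S" by (rule Poly_Mapping.keys_add)
  then show "linext f (x + y) = linext f x + linext f y"
    by (simp add: linext_superset[of ?S] lookup_add scaleR_add_left sum.distrib)
  have "Poly_Mapping.keys (r *\<^sub>R x) \<subseteq> Poly_Mapping.keys x" by (auto simp: in_keys_iff)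
  then show "linext f (r *\<^sub>R x) = r *\<^sub>R linext f x"
    by (simp add: linext_superset[of "Poly_Mapping.keys x"] scaleR_sum_right)
qed

lemma linext_single [simp]: "linext f (Poly_Mapping.single k 1) = f k"
  by (simp add: linext_def)

lemma linext_id: "linext (\<lambda>k. Poly_Mapping.single k 1) x = x"
proof (rule poly_mapping_eqI)
  fix k
  show "Poly_Mapping.lookup (linext (\<lambda>k. Poly_Mapping.single k 1) x) k = Poly_Mapping.lookup x k"
    by (auto simp: linext_def lookup_sum lookup_single when_def if_distrib in_keys_iff cong: if_cong)
qed

lemma linear_eq_linext:
  assumes "linear g"
  shows "g x = linext (\<lambda>k. g (Poly_Mapping.single k 1)) x"
proof -
  have "g x = g (linext (\<lambda>k. Poly_Mapping.single k 1) x)" by (simp add: linext_id)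
  also have "\<dots> = linext (\<lambda>k. g (Poly_Mapping.single k 1)) x"
    by (simp add: linext_def linear_sum[OF assms] linear_scale[OF assms])
  finally show ?thesis .
qed

lemma linear_linext_fun: "linear (\<lambda>y. linext (\<lambda>i. g i y) x)" if "\<And>i. linear (g i)"
  unfolding linext_def
  by (intro linear_compose_sum ballI linear_compose_scale_right that)

lemma bilinear_linext2: "bilinear (\<lambda>x y. linext (\<lambda>i. linext (f i) y) x)"
  unfolding bilinear_def by (auto intro: linear_linext linear_linext_fun)

lemma bilinear_tensor: "bilinear tensor"
  using bilinear_linext2[of "\<lambda>i j. Poly_Mapping.single (i, j) 1"]
  by (simp add: tensor_def[abs_def])

lemma lookup_tensor:
  "Poly_Mapping.lookup (tensor x y) (i, j) = Poly_Mapping.lookup x i * Poly_Mapping.lookup y j"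
proof -
  have 1: "Poly_Mapping.lookup (linext (\<lambda>j'. Poly_Mapping.single (i', j') 1) y) (i, j)
      = (if i' = i then Poly_Mapping.lookup y j else 0)" for i'
    by (auto simp: linext_def lookup_sum lookup_single when_def if_distrib in_keys_iff cong: if_cong)
  show ?thesis
    unfolding tensor_def linext_def[of _ x]
    by (auto simp: lookup_sum 1 if_distrib in_keys_iff cong: if_cong)
qed


section \<open>The reflection representation\<close>

definition sroot :: "vertex \<Rightarrow> (vertex \<Rightarrow>\<^sub>0 real)" where
  "sroot i = Poly_Mapping.single i 1"

definition refl_rep :: "nat \<Rightarrow> nat \<Rightarrow> nat \<Rightarrow> (vertex \<Rightarrow>\<^sub>0 real) set" where
  "refl_rep a b c = span (sroot ` verts a b c)"

definition Bform :: "nat \<Rightarrow> nat \<Rightarrow> nat \<Rightarrow> (vertex \<Rightarrow>\<^sub>0 real) \<Rightarrow> (vertex \<Rightarrow>\<^sub>0 real) \<Rightarrow> real" where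
  "Bform a b c x y = linext (\<lambda>i. linext (\<lambda>j. cartan a b c i j) y) x"

definition reflection :: "nat \<Rightarrow> nat \<Rightarrow> nat \<Rightarrow> vertex \<Rightarrow> (vertex \<Rightarrow>\<^sub>0 real) \<Rightarrow> (vertex \<Rightarrow>\<^sub>0 real)" where
  "reflection a b c i v = v - Bform a b c (sroot i) v *\<^sub>R sroot i"

text \<open>
  The generators of the Coxeter group \<open>W\<close> are involutions, so each element of \<open>W\<close> is represented
  by a word (a list of vertices) and acts as the composite of the corresponding reflections.
  The defining relations of \<open>W\<close> hold for the reflections, by the lemmas
  \<open>reflection_involution\<close>, \<open>reflection_commute\<close> and \<open>reflection_braid\<close> below.
\<close>

definition act :: "nat \<Rightarrow> nat \<Rightarrow> nat \<Rightarrow> vertex list \<Rightarrow> (vertex \<Rightarrow>\<^sub>0 real) \<Rightarrow> (vertex \<Rightarrow>\<^sub>0 real)" where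
  "act a b c w v = foldr (reflection a b c) w v"

definition roots :: "nat \<Rightarrow> nat \<Rightarrow> nat \<Rightarrow> (vertex \<Rightarrow>\<^sub>0 real) set" where
  "roots a b c = {act a b c w (sroot i) | w i. w \<in> lists (verts a b c) \<and> i \<in> verts a b c}"

definition pos_roots :: "nat \<Rightarrow> nat \<Rightarrow> nat \<Rightarrow> (vertex \<Rightarrow>\<^sub>0 real) set" where
  "pos_roots a b c = {\<beta> \<in> roots a b c. \<forall>i. Poly_Mapping.lookup \<beta> i \<ge> 0}"

lemma Bform_bilinear: "bilinear (Bform a b c)"
  unfolding Bform_def[abs_def] by (rule bilinear_linext2)

lemma Bform_sroot: "Bform a b c (sroot i) (sroot j) = cartan a b c i j"
  by (simp add: Bform_def sroot_def)

lemma cartan_sym: "cartan a b c i j = cartan a b c j i"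
  by (auto simp: cartan_def adj_def)

lemma linear_Bform: "linear (Bform a b c x)"
  using Bform_bilinear by (simp add: bilinear_def)

lemma linear_reflection: "linear (reflection a b c i)"
  unfolding reflection_def[abs_def]
  by (intro linear_compose_sub linear_id[unfolded id_def] linearI)
     (simp_all add: linear_add[OF linear_Bform] linear_scale[OF linear_Bform] scaleR_add_left)

lemma Bform_sroot_reflection:
  "Bform a b c (sroot i) (reflection a b c j v) =
   Bform a b c (sroot i) v - Bform a b c (sroot j) v * cartan a b c i j"
  by (simp add: reflection_def linear_diff[OF linear_Bform] linear_scale[OF linear_Bform] Bform_sroot)

lemma reflection_involution: "reflection a b c i (reflection a b c i v) = v"
  unfolding reflection_def[of a b c i "reflection a b c i v"] Bform_sroot_reflection
  by (simp add: reflection_def cartan_def algebra_simps)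

lemma reflection_commute:
  assumes "cartan a b c i j = 0"
  shows "reflection a b c i (reflection a b c j v) = reflection a b c j (reflection a b c i v)"
  using assms cartan_sym[of a b c j i]
  unfolding reflection_def[of a b c i "reflection a b c j v"]
    reflection_def[of a b c j "reflection a b c i v"] Bform_sroot_reflection
  by (simp add: reflection_def algebra_simps)

lemma reflection_braid:
  assumes "cartan a b c i j = -1"
  shows "reflection a b c i (reflection a b c j (reflection a b c i v)) =
         reflection a b c j (reflection a b c i (reflection a b c j v))"
proof -
  have R: "reflection a b c i (reflection a b c j (reflection a b c i v)) =
      v - (Bform a b c (sroot i) v + Bform a b c (sroot j) v) *\<^sub>R (sroot i + sroot j)"
    if A: "cartan a b c i j = -1" for i j
  proof -
    have d: "cartan a b c i i = 2" and s: "cartan a b c j i = -1"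
      using A cartan_sym[of a b c i j] by (simp_all add: cartan_def)
    have 1: "Bform a b c (sroot j) (reflection a b c i v) =
        Bform a b c (sroot j) v + Bform a b c (sroot i) v"
      by (simp add: Bform_sroot_reflection s)
    have 2: "Bform a b c (sroot i) (reflection a b c j (reflection a b c i v)) =
        Bform a b c (sroot j) v"
      by (simp add: Bform_sroot_reflection A s d)
    have 3: "reflection a b c i (reflection a b c j (reflection a b c i v)) =
        reflection a b c j (reflection a b c i v) - Bform a b c (sroot j) v *\<^sub>R sroot i"
      by (subst reflection_def) (simp only: 2)
    have 4: "reflection a b c j (reflection a b c i v) =
        reflection a b c i v - (Bform a b c (sroot j) v + Bform a b c (sroot i) v) *\<^sub>R sroot j"
      by (subst reflection_def) (simp only: 1)
    show ?thesis
      unfolding 3 unfolding 4 unfolding reflection_def[of a b c i v]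
      by (simp add: scaleR_add_left scaleR_add_right)
  qed
  show ?thesis
    using R[OF assms] R[of j i] assms cartan_sym[of a b c i j] by (simp add: add.commute)
qed


section \<open>The symmetric square and the kernel of the form\<close>

definition sym_square :: "nat \<Rightarrow> nat \<Rightarrow> nat \<Rightarrow> (vertex \<times> vertex \<Rightarrow>\<^sub>0 real) set" where
  "sym_square a b c = span {sym_tensor x y | x y. x \<in> refl_rep a b c \<and> y \<in> refl_rep a b c}"

definition Blin :: "nat \<Rightarrow> nat \<Rightarrow> nat \<Rightarrow> (vertex \<times> vertex \<Rightarrow>\<^sub>0 real) \<Rightarrow> real" where
  "Blin a b c = linext (\<lambda>(i, j). cartan a b c i j)"

definition kerB :: "nat \<Rightarrow> nat \<Rightarrow> nat \<Rightarrow> (vertex \<times> vertex \<Rightarrow>\<^sub>0 real) set" where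
  "kerB a b c = {t \<in> sym_square a b c. Blin a b c t = 0}"

lemma linear_Blin: "linear (Blin a b c)"
  unfolding Blin_def by (rule linear_linext)

lemma linext_tensor:
  "linext f (tensor x y) = linext (\<lambda>i. linext (\<lambda>j. f (i, j)) y) x"
  unfolding tensor_def linext_def[of _ x] linext_def[of _ y]
  by (simp add: linear_sum[OF linear_linext] linear_scale[OF linear_linext])

lemma Blin_tensor: "Blin a b c (tensor x y) = Bform a b c x y"
  by (simp add: Blin_def Bform_def linext_tensor)

lemma diag_tensor:
  assumes "linear f"
  shows "diag f (tensor x y) = tensor (f x) (f y)"
proof -
  have l: "linear (\<lambda>u. tensor u z)" and r: "linear (tensor z)" for z :: "'a \<Rightarrow>\<^sub>0 real"
    using bilinear_tensor by (auto simp: bilinear_def)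
  have "tensor (f x) (f y) = linext (\<lambda>i. tensor (f (Poly_Mapping.single i 1)) (f y)) x"
    using linear_eq_linext[OF linear_compose[OF assms l[of "f y"]], of x] by (simp add: o_def)
  also have "\<dots> = linext (\<lambda>i. linext (\<lambda>j. tensor (f (Poly_Mapping.single i 1))
      (f (Poly_Mapping.single j 1))) y) x"
    using linear_eq_linext[OF linear_compose[OF assms r], of _ y] by (simp add: o_def)
  finally show ?thesis by (simp add: diag_def linext_tensor)
qed

lemma Bform_sym: "Bform a b c x y = Bform a b c y x"
proof -
  have "Bform a b c x y = linext (\<lambda>i. linext (\<lambda>j. cartan a b c j i) y) x"
    unfolding Bform_def using cartan_sym[of a b c] by simp
  also have "\<dots> = Bform a b c y x"
    unfolding Bform_def linext_def
    by (simp add: sum_distrib_left algebra_simps) (rule sum.swap)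
  finally show ?thesis .
qed

lemma Bform_reflection:
  "Bform a b c (reflection a b c i x) (reflection a b c i y) = Bform a b c x y"
proof -
  have s: "Bform a b c (u - r *\<^sub>R u') v = Bform a b c u v - r * Bform a b c u' v" for u u' v r
    by (simp add: bilinear_lsub[OF Bform_bilinear] bilinear_lmul[OF Bform_bilinear])
  show ?thesis
    unfolding reflection_def s
    by (simp add: linear_diff[OF linear_Bform] linear_scale[OF linear_Bform] Bform_sroot
        cartan_def Bform_sym[of a b c x "sroot i"])
qed

lemma act_Cons: "act a b c (i # w) = reflection a b c i \<circ> act a b c w"
  by (auto simp: act_def)

lemma linear_act: "linear (act a b c w)"
proof (induction w)
  case Nil
  then show ?case by (simp add: act_def[abs_def] linear_id[unfolded id_def])
next
  case (Cons i w)
  then show ?case unfolding act_Cons by (rule linear_compose[OF _ linear_reflection])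
qed

lemma Bform_act: "Bform a b c (act a b c w x) (act a b c w y) = Bform a b c x y"
  by (induction w) (simp_all add: act_Cons Bform_reflection, simp add: act_def)

lemma act_refl_rep:
  assumes "w \<in> lists (verts a b c)" "x \<in> refl_rep a b c"
  shows "act a b c w x \<in> refl_rep a b c"
  using assms(1)
proof (induction w)
  case Nil
  then show ?case by (simp add: act_def assms(2))
next
  case (Cons i w)
  then show ?case
    by (auto simp: act_Cons reflection_def refl_rep_def intro!: span_diff span_scale[OF span_base])
qed

text \<open>\<open>ker B\<close> is a submodule of \<open>S\<^sup>2(V)\<close>.\<close>

lemma subspace_kerB: "subspace (kerB a b c)"
  unfolding kerB_def sym_square_def
  by (auto simp: subspace_def span_zero span_add span_scale linear_add[OF linear_Blin]
      linear_scale[OF linear_Blin] linear_0[OF linear_Blin])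

lemma diag_act_kerB:
  assumes w: "w \<in> lists (verts a b c)" and t: "t \<in> kerB a b c"
  shows "diag (act a b c w) t \<in> kerB a b c"
proof -
  let ?D = "diag (act a b c w)"
  let ?G = "{sym_tensor x y | x y. x \<in> refl_rep a b c \<and> y \<in> refl_rep a b c}"
  have lin: "linear ?D" unfolding diag_def by (rule linear_linext)
  have D: "?D (sym_tensor x y) = sym_tensor (act a b c w x) (act a b c w y)" for x y
    by (simp add: sym_tensor_def linear_add[OF lin] diag_tensor[OF linear_act])
  have "?D ` span ?G = span (?D ` ?G)" by (simp add: linear_span_image[OF lin])
  also have "\<dots> \<subseteq> span ?G"
    by (rule span_mono) (use D act_refl_rep[OF w] in blast)
  finally have mem: "?D t \<in> sym_square a b c"
    using t by (auto simp: kerB_def sym_square_def)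
  have "Blin a b c (?D s) = Blin a b c s" if "s \<in> span ?G" for s
  proof (rule linear_eq_on_span[OF linear_compose[OF lin linear_Blin] linear_Blin _ that,
        unfolded o_def])
    fix g assume "g \<in> ?G"
    then show "Blin a b c (?D g) = Blin a b c g"
      by (auto simp: D) (simp add: sym_tensor_def linear_add[OF linear_Blin] Blin_tensor Bform_act)
  qed
  then show ?thesis using mem t by (auto simp: kerB_def sym_square_def)
qed


section \<open>Elementary roots\<close>

fun path_to_branch :: "vertex \<Rightarrow> vertex set" where
  "path_to_branch Branch = {Branch}"
| "path_to_branch (Arm k l) = insert Branch {Arm k m | m. m \<le> l}"

definition D_support :: "nat \<Rightarrow> nat \<Rightarrow> nat \<Rightarrow> vertex \<Rightarrow> vertex set" where
  "D_support a b c i = path_to_branch i \<union> {j. adj a b c Branch j}"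

text \<open>
  Highest root of the parabolic subsystem with simple roots indexed by \<open>S\<close>, when the subdiagram
  on \<open>S\<close> has type \<open>D\<^sub>m\<close> with \<open>m \<ge> 4\<close>.
\<close>

definition highest_D :: "nat \<Rightarrow> nat \<Rightarrow> nat \<Rightarrow> vertex set \<Rightarrow> (vertex \<Rightarrow>\<^sub>0 real)" where
  "highest_D a b c S =
     (\<Sum>j\<in>S. (if card {h \<in> S. adj a b c j h} = 1 then 1 else 2) *\<^sub>R sroot j)"

definition theta :: "nat \<Rightarrow> nat \<Rightarrow> nat \<Rightarrow> vertex \<Rightarrow> (vertex \<Rightarrow>\<^sub>0 real)" where
  "theta a b c i = highest_D a b c (D_support a b c i)"

definition elementary :: "nat \<Rightarrow> nat \<Rightarrow> nat \<Rightarrow> vertex \<Rightarrow> (vertex \<Rightarrow>\<^sub>0 real) \<Rightarrow> bool" where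
  "elementary a b c i \<beta> \<longleftrightarrow>
     \<beta> \<in> pos_roots a b c \<and>
     ((\<exists>j\<in>verts a b c. \<beta> = sroot j \<and> cartan a b c i j = 0) \<or>
      (\<exists>h j. h \<noteq> j \<and> adj a b c h i \<and> adj a b c i j \<and> \<beta> = sroot h + sroot i + sroot j) \<or>
      (i \<noteq> Branch \<and> \<beta> = theta a b c i))"

definition elementary_basis :: "nat \<Rightarrow> nat \<Rightarrow> nat \<Rightarrow> (vertex \<times> vertex \<Rightarrow>\<^sub>0 real) set" where
  "elementary_basis a b c =
     {sym_tensor (sroot i) \<beta> | i \<beta>. i \<in> verts a b c \<and> elementary a b c i \<beta>}"

end

theory Submission
  imports Defs
begin

text \<open>
  Write \<open>q = \<alpha>\<^sub>0 \<or> \<alpha>\<^sub>0\<close> for the branch vertex \<open>0\<close> and \<open>N\<close> for the span of the elementary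
  tensors. Every elementary \<open>\<beta>\<close> is orthogonal to its \<open>\<alpha>\<^sub>i\<close>, so \<open>N \<subseteq> ker B\<close>.

  Everything else follows from the congruences
  \<open>\<alpha>\<^sub>i \<or> \<alpha>\<^sub>j \<equiv> (A\<^sub>i\<^sub>j / 2) q\<close> modulo \<open>N\<close>.
  For nonadjacent \<open>i \<noteq> j\<close> the left side is itself elementary. At the branch vertex, the three
  relations \<open>\<alpha>\<^sub>0 \<or> (\<alpha>\<^sub>h + \<alpha>\<^sub>0 + \<alpha>\<^sub>j) \<equiv> 0\<close> are a linear system for the three
  tensors \<open>\<alpha>\<^sub>0 \<or> \<alpha>\<^sub>h\<close>, with the common solution \<open>-q/2\<close>. From there the congruences spread
  outwards along each arm. If \<open>p\<close> is the neighbour of \<open>i\<close> on the side of the branch vertex, then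
  \<open>\<theta>\<^sub>i\<close> is \<open>\<alpha>\<^sub>i + 2 \<alpha>\<^sub>p\<close> plus simple roots not adjacent to \<open>i\<close>, so the congruence for the
  edge \<open>{i, p}\<close> gives the one for the square \<open>\<alpha>\<^sub>i \<or> \<alpha>\<^sub>i\<close> (lemma \<open>reduces_with_self\<close>); and
  the path \<open>p\<close>--\<open>i\<close>--\<open>h\<close> then gives it for the next edge \<open>{i, h}\<close> (lemma
  \<open>reduces_with_inward\<close>).

  By linearity \<open>t \<equiv> (B(t) / 4) q\<close> for all \<open>t\<close> in \<open>S\<^sup>2(V)\<close>, since \<open>B(\<alpha>\<^sub>i \<or> \<alpha>\<^sub>j) = 2 A\<^sub>i\<^sub>j\<close>;
  hence \<open>ker B \<subseteq> N\<close>. Independence is a count: the elementary tensors together with \<open>q\<close> span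
  \<open>S\<^sup>2(V)\<close>, and they can be indexed by unordered pairs of vertices (lemma
  \<open>elementary_basis_subset_elementary_at\<close>), so there are at most as many of them as there are
  independent tensors \<open>\<alpha>\<^sub>i \<or> \<alpha>\<^sub>j\<close>.

  The elementary elements also have to be roots. Adding \<open>\<alpha>\<^sub>i\<close> to a root \<open>\<beta>\<close> with
  \<open>B(\<alpha>\<^sub>i, \<beta>) = -1\<close> is the reflection \<open>s\<^sub>i\<close>, and each of them is reached from a simple root
  by such steps.
\<close>

section \<open>Linear algebra\<close>

lemma independent_if_dual_functionals:
  fixes S :: "'v::real_vector set"
  assumes "\<And>x. x \<in> S \<Longrightarrow> \<exists>\<phi> :: 'v \<Rightarrow> real. linear \<phi> \<and> \<phi> x \<noteq> 0 \<and> (\<forall>y\<in>S - {x}. \<phi> y = 0)"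
  shows "independent S"
proof
  assume "dependent S"
  then obtain x where x: "x \<in> S" "x \<in> span (S - {x})" by (auto simp: dependent_def)
  obtain \<phi> :: "'v \<Rightarrow> real" where \<phi>: "linear \<phi>" "\<phi> x \<noteq> 0" "\<forall>y\<in>S - {x}. \<phi> y = 0"
    using assms[OF x(1)] by blast
  then have "\<phi> x = 0" using linear_eq_0_on_span[OF \<phi>(1) _ x(2)] by blast
  with \<phi>(2) show False by simp
qed

text \<open>
  A dependent \<open>S\<close> has a redundant element; without it, \<open>S\<close> would span the independent set \<open>P\<close>
  with fewer than \<open>card P\<close> vectors.
\<close>

lemma independent_if_card_le:
  fixes S P :: "'v::real_vector set"
  assumes "finite S" "independent P" "P \<subseteq> span S" "card S \<le> card P"
  shows "independent S"
proof
  assume "dependent S"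
  then obtain x where x: "x \<in> S" "x \<in> span (S - {x})" by (auto simp: dependent_def)
  then have "span (S - {x}) = span S" by (metis insert_Diff span_redundant)
  then have "card P \<le> card (S - {x})"
    using independent_span_bound[of "S - {x}" P] assms by simp
  also have "\<dots> < card S" using x(1) assms(1) by (rule card_Diff1_less[rotated])
  finally show False using assms(4) by simp
qed

text \<open>
  For families indexed redundantly: every coincidence in \<open>g\<close> is one in \<open>f\<close>, so \<open>f\<close> factors
  through \<open>g\<close>. It applies to symmetric families indexed by ordered pairs of vertices.
\<close>

lemma card_image_le_card_image:
  assumes "finite A" "\<And>x y. x \<in> A \<Longrightarrow> y \<in> A \<Longrightarrow> g x = g y \<Longrightarrow> f x = f y"
  shows "card (f ` A) \<le> card (g ` A)"
proof -
  have "f x = f (inv_into A g (g x))" if "x \<in> A" for x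
    using that assms(2)[of x "inv_into A g (g x)"]
    by (simp add: inv_into_into f_inv_into_f)
  then have "f ` A \<subseteq> (f \<circ> inv_into A g) ` (g ` A)" by force
  then show ?thesis using assms(1) by (intro surj_card_le) auto
qed

lemma mem_span_sroot_if_keys_subset:
  assumes "Poly_Mapping.keys x \<subseteq> X"
  shows "x \<in> span (sroot ` X)"
proof -
  have "x = (\<Sum>k\<in>Poly_Mapping.keys x. Poly_Mapping.lookup x k *\<^sub>R sroot k)"
    using linext_id[of x] by (simp add: linext_def sroot_def)
  also have "\<dots> \<in> span (sroot ` X)"
    using assms by (intro span_sum span_scale span_base) auto
  finally show ?thesis .
qed

lemma sym_tensor_commute: "sym_tensor x y = sym_tensor y x"
  by (simp add: sym_tensor_def add.commute)

lemma linear_sym_tensor: "linear (sym_tensor x)"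
proof -
  have "linear (\<lambda>y. tensor x y + tensor y x)"
    using bilinear_tensor by (intro linear_compose_add) (auto simp: bilinear_def)
  then show ?thesis by (simp add: sym_tensor_def[abs_def])
qed

lemma Blin_sym_tensor: "Blin a b c (sym_tensor x y) = 2 * Bform a b c x y"
  by (simp add: sym_tensor_def linear_add[OF linear_Blin] Blin_tensor Bform_sym[of a b c y x])

lemma lookup_sroot: "Poly_Mapping.lookup (sroot i) j = (if i = j then 1 else 0)"
  by (simp add: sroot_def lookup_single when_def)

lemma lookup_sym_tensor_sroot:
  "Poly_Mapping.lookup (sym_tensor (sroot i) (sroot j)) (k, l) =
   (if i = k \<and> j = l then 1 else 0) + (if j = k \<and> i = l then 1 else 0)"
  unfolding sym_tensor_def lookup_add lookup_tensor lookup_sroot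
  by (cases "i = k"; cases "j = l"; cases "j = k"; cases "i = l") (simp_all only: if_True if_False
      simp_thms mult_1_left mult_1_right mult_zero_left mult_zero_right)

lemma lookup_sym_tensor_sroot_nonzero_iff:
  "Poly_Mapping.lookup (sym_tensor (sroot i) (sroot j)) (k, l) \<noteq> 0 \<longleftrightarrow>
   (i = k \<and> j = l) \<or> (j = k \<and> i = l)"
proof -
  have "(if p then 1 else 0) + (if q then 1 else 0) \<noteq> (0::real) \<longleftrightarrow> p \<or> q" for p q
    by simp
  then show ?thesis unfolding lookup_sym_tensor_sroot .
qed

lemma sym_tensor_sroot_eq_iff:
  "sym_tensor (sroot i) (sroot j) = sym_tensor (sroot k) (sroot l) \<longleftrightarrow>
   (i = k \<and> j = l) \<or> (j = k \<and> i = l)"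
proof
  assume eq: "sym_tensor (sroot i) (sroot j) = sym_tensor (sroot k) (sroot l)"
  have "Poly_Mapping.lookup (sym_tensor (sroot k) (sroot l)) (k, l) \<noteq> 0"
    by (simp only: lookup_sym_tensor_sroot_nonzero_iff simp_thms)
  then have "Poly_Mapping.lookup (sym_tensor (sroot i) (sroot j)) (k, l) \<noteq> 0"
    unfolding eq .
  then show "(i = k \<and> j = l) \<or> (j = k \<and> i = l)"
    by (simp only: lookup_sym_tensor_sroot_nonzero_iff)
next
  assume "(i = k \<and> j = l) \<or> (j = k \<and> i = l)"
  then show "sym_tensor (sroot i) (sroot j) = sym_tensor (sroot k) (sroot l)"
  proof (elim disjE conjE)
    assume "j = k" "i = l"
    then show ?thesis by (simp only: sym_tensor_commute[of "sroot l" "sroot k"])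
  qed (simp only:)
qed

lemma linear_lookup: "linear (\<lambda>x :: 'k \<Rightarrow>\<^sub>0 real. Poly_Mapping.lookup x k)"
  by (rule linearI) (simp_all add: lookup_add)

text \<open>
  The coordinate at \<open>(i, j)\<close> vanishes on every \<open>\<alpha>\<^sub>k \<or> \<alpha>\<^sub>l\<close> other than
  \<open>\<alpha>\<^sub>i \<or> \<alpha>\<^sub>j\<close>, so the coordinates are dual functionals up to scaling.
\<close>

lemma independent_sym_tensor_sroot:
  "independent ((\<lambda>(i, j). sym_tensor (sroot i) (sroot j)) ` X)"
proof (rule independent_if_dual_functionals)
  fix x assume "x \<in> (\<lambda>(i, j). sym_tensor (sroot i) (sroot j)) ` X"
  then obtain i j where x: "x = sym_tensor (sroot i) (sroot j)" by auto
  let ?\<phi> = "\<lambda>x. Poly_Mapping.lookup x (i, j) :: real"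
  have "?\<phi> x \<noteq> 0" unfolding x lookup_sym_tensor_sroot_nonzero_iff by blast
  moreover have "?\<phi> y = 0" if y_in: "y \<in> (\<lambda>(i, j). sym_tensor (sroot i) (sroot j)) ` X - {x}" for y
  proof -
    obtain k l where y: "y = sym_tensor (sroot k) (sroot l)" "y \<noteq> x" using y_in by auto
    then have "sym_tensor (sroot k) (sroot l) \<noteq> sym_tensor (sroot i) (sroot j)"
      unfolding x by simp
    then show ?thesis
      unfolding y(1) sym_tensor_sroot_eq_iff
      by (rule contrapos_np) (simp only: lookup_sym_tensor_sroot_nonzero_iff)
  qed
  ultimately show "\<exists>\<phi> :: _ \<Rightarrow> real. linear \<phi> \<and> \<phi> x \<noteq> 0 \<and>
      (\<forall>y\<in>(\<lambda>(i, j). sym_tensor (sroot i) (sroot j)) ` X - {x}. \<phi> y = 0)"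
    by (intro exI[of _ ?\<phi>] conjI ballI linear_lookup)
qed


section \<open>The tree and its roots\<close>

lemma UNIV_arm: "UNIV = {ArmA, ArmB, ArmC}"
  by (auto intro: arm.exhaust)

lemma towards_simps [simp]:
  "\<not> towards Branch j"
  "towards (Arm k l) Branch \<longleftrightarrow> l = 0"
  "towards (Arm k l) (Arm k' m) \<longleftrightarrow> k' = k \<and> l = Suc m"
  by (auto simp: towards.simps)

fun inward :: "vertex \<Rightarrow> vertex" where
  "inward Branch = Branch"
| "inward (Arm k 0) = Branch"
| "inward (Arm k (Suc l)) = Arm k l"

lemma towards_iff_inward: "towards i j \<longleftrightarrow> i \<noteq> Branch \<and> j = inward i"
  by (cases i rule: inward.cases; cases j) auto

lemma Branch_in_verts [simp]: "Branch \<in> verts a b c"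
  by (simp add: verts_def)

lemma Arm_in_verts [simp]: "Arm k l \<in> verts a b c \<longleftrightarrow> l < arm_length a b c k"
  by (simp add: verts_def)

lemma inward_in_verts: "i \<in> verts a b c \<Longrightarrow> inward i \<in> verts a b c"
  by (cases i rule: inward.cases) auto

lemma finite_verts: "finite (verts a b c)"
proof -
  have "verts a b c = insert Branch (\<Union>k\<in>UNIV. Arm k ` {..<arm_length a b c k})"
    by (auto simp: verts_def)
  then show ?thesis by (simp add: UNIV_arm)
qed

lemma cartan_cases:
  assumes "i \<in> verts a b c" "j \<in> verts a b c"
  obtains "cartan a b c i j = 0" | "i = j" | "towards i j" | "towards j i"
  using assms by (cases "i = j"; cases "adj a b c i j") (auto simp: cartan_def adj_def)

lemma not_towards_both: "towards i j \<Longrightarrow> \<not> towards j i"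
  by (cases i; cases j) auto

lemma cartan_adj: "adj a b c i j \<Longrightarrow> cartan a b c i j = -1"
  by (cases i; cases j) (auto simp: adj_def cartan_def)

lemma cartan_inward:
  assumes "i \<in> verts a b c" "i \<noteq> Branch"
  shows "cartan a b c i (inward i) = -1"
  using assms inward_in_verts[OF assms(1)]
  by (intro cartan_adj) (simp add: adj_def towards_iff_inward)

lemma Bform_add_right: "Bform a b c x (y + z) = Bform a b c x y + Bform a b c x z"
  by (rule linear_add[OF linear_Bform])

lemma Bform_scaleR_right: "Bform a b c x (r *\<^sub>R y) = r * Bform a b c x y"
  by (simp add: linear_scale[OF linear_Bform])

lemma reflection_in_roots:
  assumes "\<beta> \<in> roots a b c" "i \<in> verts a b c"
  shows "reflection a b c i \<beta> \<in> roots a b c"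
proof -
  obtain w j where w: "w \<in> lists (verts a b c)" "j \<in> verts a b c" "\<beta> = act a b c w (sroot j)"
    using assms(1) by (auto simp: roots_def)
  then have "reflection a b c i \<beta> = act a b c (i # w) (sroot j)" "i # w \<in> lists (verts a b c)"
    using assms(2) by (simp_all add: act_Cons)
  then show ?thesis using w(2) unfolding roots_def by blast
qed

text \<open>Under this condition, \<open>\<beta> + \<alpha>\<^sub>i\<close> is the reflected root \<open>s\<^sub>i(\<beta>)\<close>.\<close>

lemma pos_roots_add_sroot:
  assumes "\<beta> \<in> pos_roots a b c" "i \<in> verts a b c" "Bform a b c (sroot i) \<beta> = -1"
  shows "\<beta> + sroot i \<in> pos_roots a b c"
  using assms reflection_in_roots[of \<beta> a b c i]
  by (auto simp: pos_roots_def reflection_def lookup_add lookup_sroot)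

lemma sroot_in_pos_roots: "i \<in> verts a b c \<Longrightarrow> sroot i \<in> pos_roots a b c"
  unfolding pos_roots_def roots_def
  by (auto simp: lookup_sroot act_def intro!: exI[of _ "[]"])

lemma path_root_in_pos_roots:
  assumes "h \<noteq> j" "adj a b c h i" "adj a b c i j"
  shows "sroot h + sroot i + sroot j \<in> pos_roots a b c"
proof -
  have v: "h \<in> verts a b c" "i \<in> verts a b c" "j \<in> verts a b c"
    using assms by (auto simp: adj_def)
  have hi: "cartan a b c h i = -1"
    by (rule cartan_adj[OF assms(2)])
  have ji: "cartan a b c j i = -1"
    using cartan_adj[OF assms(3)] by (simp add: cartan_sym[of a b c j i])
  have jh: "cartan a b c j h = 0"
    using assms by (cases j; cases i; cases h) (auto simp: adj_def cartan_def)
  have "sroot i + sroot h \<in> pos_roots a b c"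
    using v hi by (intro pos_roots_add_sroot sroot_in_pos_roots) (auto simp: Bform_sroot)
  then have "sroot i + sroot h + sroot j \<in> pos_roots a b c"
    by (rule pos_roots_add_sroot) (simp_all add: v ji jh Bform_add_right Bform_sroot)
  then show ?thesis by (simp add: ac_simps)
qed

lemma pos_roots_subset_refl_rep: "pos_roots a b c \<subseteq> refl_rep a b c"
proof
  fix \<beta> assume "\<beta> \<in> pos_roots a b c"
  then obtain w i where "w \<in> lists (verts a b c)" "i \<in> verts a b c" "\<beta> = act a b c w (sroot i)"
    by (auto simp: pos_roots_def roots_def)
  moreover from this have "sroot i \<in> refl_rep a b c" by (auto simp: refl_rep_def intro: span_base)
  ultimately show "\<beta> \<in> refl_rep a b c" by (simp add: act_refl_rep)
qed

text \<open>
  Since \<open>i\<close> itself has \<open>A\<^sub>i\<^sub>i = 2\<close>, these are the combinations of simple roots at vertices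
  different from \<open>i\<close> and not adjacent to it. They are the part of a vector that contributes
  nothing to its product with \<open>\<alpha>\<^sub>i\<close>, neither under \<open>B\<close> nor, modulo the elementary tensors,
  in the symmetric square.
\<close>

definition orth_span :: "nat \<Rightarrow> nat \<Rightarrow> nat \<Rightarrow> vertex \<Rightarrow> (vertex \<Rightarrow>\<^sub>0 real) set" where
  "orth_span a b c i = span (sroot ` {j \<in> verts a b c. cartan a b c i j = 0})"

lemma Bform_orth_span: "x \<in> orth_span a b c i \<Longrightarrow> Bform a b c (sroot i) x = 0"
  unfolding orth_span_def
  by (rule linear_eq_0_on_span[OF linear_Bform]) (auto simp: Bform_sroot)

text \<open>
  Nonempty arms make the branch vertex trivalent. The coefficient \<open>2\<close> of \<open>\<theta>\<^sub>i\<close> at the branch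
  vertex and the three paths through it depend on this.
\<close>

locale Y_tree =
  fixes a b c :: nat
  assumes arms_nonempty: "a \<ge> 1" "b \<ge> 1" "c \<ge> 1"
begin

lemma arm_length_pos [simp]: "0 < arm_length a b c k" "0 < a" "0 < b" "0 < c"
  using arms_nonempty by (cases k; simp)+

lemma adj_simps [simp]:
  "\<not> adj a b c Branch Branch"
  "adj a b c Branch (Arm k l) \<longleftrightarrow> l = 0"
  "adj a b c (Arm k l) Branch \<longleftrightarrow> l = 0"
  "adj a b c (Arm k l) (Arm k' m) \<longleftrightarrow> k' = k \<and> (l = Suc m \<or> m = Suc l)
      \<and> l < arm_length a b c k \<and> m < arm_length a b c k"
  by (auto simp: adj_def)


section \<open>Highest roots of the subsystems of type D\<close>

lemma D_support_Arm:
  assumes "l < arm_length a b c k"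
  shows "D_support a b c (Arm k l) =
    insert Branch ((\<lambda>m. Arm k m) ` {..l} \<union> range (\<lambda>k'. Arm k' 0))"
proof -
  have "adj a b c Branch j \<longleftrightarrow> j \<in> range (\<lambda>k'. Arm k' 0)" for j
    by (cases j) auto
  then show ?thesis by (auto simp: D_support_def)
qed

lemma D_support_neighbours:
  assumes "l < arm_length a b c k"
  shows "{h \<in> D_support a b c (Arm k l). adj a b c Branch h} = range (\<lambda>k'. Arm k' 0)"
    and "m < l \<Longrightarrow> {h \<in> D_support a b c (Arm k l). adj a b c (Arm k m) h}
      = {inward (Arm k m), Arm k (Suc m)}"
    and "{h \<in> D_support a b c (Arm k l). adj a b c (Arm k l) h} = {inward (Arm k l)}"
    and "k' \<noteq> k \<Longrightarrow> {h \<in> D_support a b c (Arm k l). adj a b c (Arm k' 0) h} = {Branch}"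
proof -
  show "{h \<in> D_support a b c (Arm k l). adj a b c Branch h} = range (\<lambda>k'. Arm k' 0)"
    unfolding D_support_Arm[OF assms] by auto
  show "{h \<in> D_support a b c (Arm k l). adj a b c (Arm k l) h} = {inward (Arm k l)}"
    using assms unfolding D_support_Arm[OF assms] by (cases l) auto
  show "{h \<in> D_support a b c (Arm k l). adj a b c (Arm k m) h}
      = {inward (Arm k m), Arm k (Suc m)}" if "m < l"
    using assms that unfolding D_support_Arm[OF assms] by (cases m) auto
  show "{h \<in> D_support a b c (Arm k l). adj a b c (Arm k' 0) h} = {Branch}" if "k' \<noteq> k"
    using assms that unfolding D_support_Arm[OF assms] by auto
qed

text \<open>
  Coefficient \<open>1\<close> occurs at the endpoints of the diagram: at \<open>i\<close> and at the first vertices of the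
  two other arms.
\<close>

lemma lookup_theta:
  assumes "l < arm_length a b c k"
  shows "Poly_Mapping.lookup (theta a b c (Arm k l)) v =
    (case v of Branch \<Rightarrow> 2
     | Arm k' m \<Rightarrow> if k' = k then (if m < l then 2 else if m = l then 1 else 0)
        else if m = 0 then 1 else 0)"
proof -
  let ?S = "D_support a b c (Arm k l)"
  have finite_S: "finite ?S" unfolding D_support_Arm[OF assms] by (simp add: UNIV_arm)
  have scaleR_delta: "r *\<^sub>R (if x = v then 1 else 0) = (if x = v then r else 0)" for r :: real and x
    by simp
  have *: "Poly_Mapping.lookup (theta a b c (Arm k l)) v =
      (if v \<in> ?S then if card {h \<in> ?S. adj a b c v h} = 1 then 1 else 2 else 0)"
    unfolding theta_def highest_D_def lookup_sum lookup_scaleR lookup_sroot scaleR_delta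
    using finite_S by (rule sum.delta)
  have card_arms: "card (range (\<lambda>k'. Arm k' 0)) = 3"
    by (simp add: UNIV_arm)
  have inward_ne: "inward (Arm k m) \<noteq> Arm k (Suc m)" for m
    by (cases m) auto
  show ?thesis
  proof (cases v)
    case Branch
    then show ?thesis
      unfolding * using assms
      by (simp add: D_support_neighbours card_arms) (simp add: D_support_Arm)
  next
    case (Arm k' m)
    consider "k' = k" "m < l" | "k' = k" "m = l" | "k' = k" "m > l" | "k' \<noteq> k" "m = 0"
      | "k' \<noteq> k" "m > 0"
      by linarith
    then show ?thesis
    proof cases
      case 1
      then show ?thesis
        unfolding * unfolding Arm using assms inward_ne
        by (simp add: D_support_neighbours) (simp add: D_support_Arm)
    next
      case 2
      then show ?thesis
        unfolding * unfolding Arm using assms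
        by (simp add: D_support_neighbours) (simp add: D_support_Arm)
    next
      case 3
      then show ?thesis
        unfolding * unfolding Arm using assms by (auto simp: D_support_Arm)
    next
      case 4
      then show ?thesis
        unfolding * unfolding Arm using assms
        by (simp add: D_support_neighbours) (auto simp: D_support_Arm)
    next
      case 5
      then show ?thesis
        unfolding * unfolding Arm using assms by (auto simp: D_support_Arm)
    qed
  qed
qed

text \<open>
  In type D, lengthening the arm by one vertex lets the old endpoint become an inner vertex: its
  coefficient rises from \<open>1\<close> to \<open>2\<close>. The order of the summands is that of two root additions.
\<close>

lemma theta_Suc:
  assumes "Suc l < arm_length a b c k"
  shows "theta a b c (Arm k (Suc l)) =
    theta a b c (Arm k l) + sroot (Arm k (Suc l)) + sroot (Arm k l)"
  using assms
  by (intro poly_mapping_eqI)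
     (auto simp: lookup_add lookup_theta lookup_sroot split: vertex.splits)

text \<open>
  The sum is written in an order in which every partial sum is a root: the branch vertex is counted
  for the second time only after its three neighbours have been added.
\<close>

lemma theta_0:
  "theta a b c (Arm k 0) =
    sroot Branch + sroot (Arm ArmA 0) + sroot (Arm ArmB 0) + sroot (Arm ArmC 0) + sroot Branch"
  using arm.exhaust
  by (intro poly_mapping_eqI)
     (auto simp: lookup_add lookup_theta lookup_sroot split: vertex.splits)

text \<open>
  The endpoint \<open>i\<close> of the long arm has the single neighbour \<open>inward i\<close> in the support of \<open>\<theta>\<^sub>i\<close>,
  where the coefficient is \<open>2\<close>.
\<close>

lemma theta_decomposition:
  assumes "l < arm_length a b c k"
  obtains w where "w \<in> orth_span a b c (Arm k l)"
    "theta a b c (Arm k l) = sroot (Arm k l) + 2 *\<^sub>R sroot (inward (Arm k l)) + w"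
proof
  let ?w = "theta a b c (Arm k l) - sroot (Arm k l) - 2 *\<^sub>R sroot (inward (Arm k l))"
  show "theta a b c (Arm k l) = sroot (Arm k l) + 2 *\<^sub>R sroot (inward (Arm k l)) + ?w"
    by simp
  have "v \<in> verts a b c \<and> cartan a b c (Arm k l) v = 0"
    if "Poly_Mapping.lookup ?w v \<noteq> 0" for v
    using that assms
    by (cases l; cases v)
       (auto simp: lookup_minus lookup_theta lookup_sroot cartan_def split: if_splits)
  then show "?w \<in> orth_span a b c (Arm k l)"
    unfolding orth_span_def
    by (intro mem_span_sroot_if_keys_subset subsetI) (simp add: in_keys_iff)
qed

lemma Bform_theta:
  assumes "l < arm_length a b c k"
  shows "Bform a b c (sroot (Arm k l)) (theta a b c (Arm k l)) = 0"
proof -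
  obtain w where w: "w \<in> orth_span a b c (Arm k l)"
    "theta a b c (Arm k l) = sroot (Arm k l) + 2 *\<^sub>R sroot (inward (Arm k l)) + w"
    by (rule theta_decomposition[OF assms])
  have "cartan a b c (Arm k l) (inward (Arm k l)) = -1"
    using assms by (intro cartan_inward) auto
  then show ?thesis
    by (simp add: w(2) Bform_add_right Bform_scaleR_right Bform_sroot Bform_orth_span[OF w(1)])
       (simp add: cartan_def)
qed

text \<open>
  The next vertex on the arm meets the support of \<open>\<theta>\<^sub>i\<close> only at \<open>i\<close>, where the coefficient is \<open>1\<close>.
\<close>

lemma Bform_theta_Suc:
  assumes "Suc l < arm_length a b c k"
  shows "Bform a b c (sroot (Arm k (Suc l))) (theta a b c (Arm k l)) = -1"
proof -
  let ?w = "theta a b c (Arm k l) - sroot (Arm k l)"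
  have "v \<in> verts a b c \<and> cartan a b c (Arm k (Suc l)) v = 0"
    if "Poly_Mapping.lookup ?w v \<noteq> 0" for v
    using that assms
    by (cases v)
       (auto simp: lookup_minus lookup_theta lookup_sroot cartan_def split: if_splits)
  then have "?w \<in> orth_span a b c (Arm k (Suc l))"
    unfolding orth_span_def
    by (intro mem_span_sroot_if_keys_subset subsetI) (simp add: in_keys_iff)
  then have "Bform a b c (sroot (Arm k (Suc l))) ?w = 0" by (rule Bform_orth_span)
  moreover have "cartan a b c (Arm k (Suc l)) (Arm k l) = -1"
    using assms by (simp add: cartan_def)
  ultimately show ?thesis
    by (simp add: linear_diff[OF linear_Bform] Bform_sroot)
qed

text \<open>
  Passing from \<open>\<theta>\<close> at the vertex \<open>l\<close> of an arm to \<open>\<theta>\<close> at \<open>l + 1\<close> takes two reflections. The new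
  simple root has product \<open>-1\<close> with the old \<open>\<theta>\<close>; the old end simple root is orthogonal to the
  old \<open>\<theta>\<close>, and gets product \<open>-1\<close> from the simple root just added.
\<close>

lemma theta_in_pos_roots:
  "l < arm_length a b c k \<Longrightarrow> theta a b c (Arm k l) \<in> pos_roots a b c"
proof (induction l)
  case 0
  have cartan_adjacent: "cartan a b c (Arm k' 0) Branch = -1" "cartan a b c Branch (Arm k' 0) = -1"
    for k' by (auto simp: cartan_def)
  have cartan_distinct: "k' \<noteq> k'' \<Longrightarrow> cartan a b c (Arm k' 0) (Arm k'' 0) = 0" for k' k''
    by (simp add: cartan_def)
  have cartan_self: "cartan a b c Branch Branch = 2" by (simp add: cartan_def)
  show ?case
    unfolding theta_0
    by (intro pos_roots_add_sroot sroot_in_pos_roots)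
       (auto simp: Bform_add_right Bform_sroot cartan_adjacent cartan_distinct cartan_self)
next
  case (Suc l)
  have "Bform a b c (sroot (Arm k l)) (theta a b c (Arm k l) + sroot (Arm k (Suc l))) = -1"
    using Suc.prems by (simp add: Bform_add_right Bform_theta Bform_sroot cartan_def)
  then show ?case
    unfolding theta_Suc[OF Suc.prems]
    using Suc Bform_theta_Suc by (intro pos_roots_add_sroot) auto
qed


section \<open>The elementary tensors span the kernel\<close>

lemma elementary_orth: "j \<in> verts a b c \<Longrightarrow> cartan a b c i j = 0 \<Longrightarrow> elementary a b c i (sroot j)"
  unfolding elementary_def using sroot_in_pos_roots by blast

lemma elementary_path:
  "h \<noteq> j \<Longrightarrow> adj a b c h i \<Longrightarrow> adj a b c i j \<Longrightarrow> elementary a b c i (sroot h + sroot i + sroot j)"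
  unfolding elementary_def using path_root_in_pos_roots by blast

lemma elementary_theta:
  "l < arm_length a b c k \<Longrightarrow> elementary a b c (Arm k l) (theta a b c (Arm k l))"
  unfolding elementary_def using theta_in_pos_roots by blast

lemma Bform_elementary:
  assumes "i \<in> verts a b c" "elementary a b c i \<beta>"
  shows "Bform a b c (sroot i) \<beta> = 0"
proof -
  consider j where "\<beta> = sroot j" "cartan a b c i j = 0"
    | h j where "h \<noteq> j" "adj a b c h i" "adj a b c i j" "\<beta> = sroot h + sroot i + sroot j"
    | "i \<noteq> Branch" "\<beta> = theta a b c i"
    using assms(2) unfolding elementary_def by blast
  then show ?thesis
  proof cases
    case 1
    then show ?thesis by (simp add: Bform_sroot)
  next
    case 2
    have "cartan a b c i h = -1" "cartan a b c i j = -1"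
      using cartan_adj[OF 2(2)] cartan_adj[OF 2(3)] by (simp_all add: cartan_sym[of a b c h i])
    moreover have "cartan a b c i i = 2" by (simp add: cartan_def)
    ultimately show ?thesis by (simp add: 2(4) Bform_add_right Bform_sroot)
  next
    case 3
    then show ?thesis using assms(1) Bform_theta by (cases i) auto
  qed
qed

lemma elementary_basis_subset_kerB: "elementary_basis a b c \<subseteq> kerB a b c"
proof
  fix t assume "t \<in> elementary_basis a b c"
  then obtain i \<beta> where t: "t = sym_tensor (sroot i) \<beta>" "i \<in> verts a b c" "elementary a b c i \<beta>"
    by (auto simp: elementary_basis_def)
  have "sroot i \<in> refl_rep a b c" "\<beta> \<in> refl_rep a b c"
    using subsetD[OF pos_roots_subset_refl_rep] sroot_in_pos_roots t(2,3)
    unfolding elementary_def by blast+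
  then show "t \<in> kerB a b c"
    unfolding kerB_def sym_square_def t(1)
    using Bform_elementary[OF t(2,3)] by (auto simp: Blin_sym_tensor intro: span_base)
qed

abbreviation branch_square :: "vertex \<times> vertex \<Rightarrow>\<^sub>0 real" where
  "branch_square \<equiv> sym_tensor (sroot Branch) (sroot Branch)"

text \<open>
  The coefficient \<open>B(x, y) / 2\<close> is forced: \<open>B\<close> takes the value \<open>2 B(x, y)\<close> on
  \<open>x \<or> y\<close> and \<open>4\<close> on \<open>branch_square\<close>. The condition is bundled as a set of vectors \<open>y\<close> because this set
  is a subspace, so that the congruences can be solved for a single simple root.
\<close>

definition reduces_with :: "(vertex \<Rightarrow>\<^sub>0 real) \<Rightarrow> (vertex \<Rightarrow>\<^sub>0 real) set" where
  "reduces_with x = {y. sym_tensor x y - (Bform a b c x y / 2) *\<^sub>R branch_square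
     \<in> span (elementary_basis a b c)}"

lemma reduces_with_sym: "y \<in> reduces_with x \<longleftrightarrow> x \<in> reduces_with y"
  by (simp add: reduces_with_def sym_tensor_commute[of x] Bform_sym[of a b c x])

lemma subspace_reduces_with: "subspace (reduces_with x)"
proof -
  have "linear (\<lambda>y. (Bform a b c x y / 2) *\<^sub>R branch_square)"
    by (rule linearI)
       (simp_all add: Bform_add_right Bform_scaleR_right add_divide_distrib scaleR_add_left)
  then have "linear (\<lambda>y. sym_tensor x y - (Bform a b c x y / 2) *\<^sub>R branch_square)"
    by (rule linear_compose_sub[OF linear_sym_tensor])
  then show ?thesis
    unfolding reduces_with_def by (rule linear_subspace_vimage[unfolded vimage_def, OF _ subspace_span])
qed

lemma reduces_with_elementary:
  assumes "i \<in> verts a b c" "elementary a b c i \<beta>"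
  shows "\<beta> \<in> reduces_with (sroot i)"
proof -
  have "sym_tensor (sroot i) \<beta> \<in> elementary_basis a b c"
    unfolding elementary_basis_def using assms by blast
  then show ?thesis by (simp add: reduces_with_def Bform_elementary[OF assms] span_base)
qed

lemma orth_span_subset_reduces_with:
  assumes "i \<in> verts a b c"
  shows "orth_span a b c i \<subseteq> reduces_with (sroot i)"
  unfolding orth_span_def
  by (rule span_minimal)
     (auto intro: subspace_reduces_with reduces_with_elementary[OF assms] elementary_orth)

text \<open>
  The paths through the branch vertex give \<open>x + y\<close>, \<open>x + z\<close> and \<open>y + z\<close> for its neighbours
  \<open>x, y, z\<close>, and these determine \<open>2 x\<close>.
\<close>

lemma reduces_with_Branch:
  "sroot Branch \<in> reduces_with (sroot Branch)"
  "sroot (Arm k 0) \<in> reduces_with (sroot Branch)"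
proof -
  let ?C = "reduces_with (sroot Branch)"
  note S = subspace_reduces_with[of "sroot Branch"]
  show B: "sroot Branch \<in> ?C"
    by (simp add: reduces_with_def Bform_sroot cartan_def span_zero)
  have pair: "sroot (Arm k 0) + sroot (Arm k' 0) \<in> ?C" if "k \<noteq> k'" for k k'
  proof -
    have "sroot (Arm k 0) + sroot Branch + sroot (Arm k' 0) \<in> ?C"
      using that by (intro reduces_with_elementary elementary_path) auto
    from subspace_diff[OF S this B] show ?thesis by (simp add: algebra_simps)
  qed
  obtain k' k'' where k: "k \<noteq> k'" "k \<noteq> k''" "k' \<noteq> k''"
    by (cases k) (use arm.distinct in blast)+
  have "(sroot (Arm k 0) + sroot (Arm k' 0)) + (sroot (Arm k 0) + sroot (Arm k'' 0))
      - (sroot (Arm k' 0) + sroot (Arm k'' 0)) \<in> ?C"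
    by (intro subspace_diff[OF S] subspace_add[OF S] pair k)
  then have "sroot (Arm k 0) + sroot (Arm k 0) \<in> ?C" by (simp add: algebra_simps)
  from subspace_scale[OF S this, of "1 / 2"] show "sroot (Arm k 0) \<in> ?C"
    by (simp only: scaleR_half_double)
qed

text \<open>
  Solve \<open>\<theta>\<^sub>i = \<alpha>\<^sub>i + 2 \<alpha>\<^sub>p + w\<close> for \<open>\<alpha>\<^sub>i\<close>, where \<open>p = inward i\<close> and \<open>w\<close> is orthogonal to \<open>\<alpha>\<^sub>i\<close>.
\<close>

lemma reduces_with_self:
  assumes "l < arm_length a b c k" "sroot (inward (Arm k l)) \<in> reduces_with (sroot (Arm k l))"
  shows "sroot (Arm k l) \<in> reduces_with (sroot (Arm k l))"
proof -
  let ?C = "reduces_with (sroot (Arm k l))"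
  note S = subspace_reduces_with[of "sroot (Arm k l)"]
  obtain w where w: "w \<in> orth_span a b c (Arm k l)"
    "theta a b c (Arm k l) = sroot (Arm k l) + 2 *\<^sub>R sroot (inward (Arm k l)) + w"
    by (rule theta_decomposition[OF assms(1)])
  have "theta a b c (Arm k l) \<in> ?C"
    using assms(1) by (intro reduces_with_elementary elementary_theta) auto
  moreover have "w \<in> ?C" using orth_span_subset_reduces_with[of "Arm k l"] assms(1) w(1) by auto
  ultimately have "theta a b c (Arm k l) - 2 *\<^sub>R sroot (inward (Arm k l)) - w \<in> ?C"
    using assms(2) by (intro subspace_diff[OF S] subspace_scale[OF S])
  then show ?thesis by (simp add: w(2))
qed

text \<open>
  Induction outwards along the arm. At the inner vertex \<open>i\<close> the path root leaves only the outer
  neighbour \<open>h\<close> undetermined; by symmetry this is the statement about the pair \<open>h\<close>, \<open>i = inward h\<close>.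
\<close>

lemma reduces_with_inward:
  "l < arm_length a b c k \<Longrightarrow> sroot (inward (Arm k l)) \<in> reduces_with (sroot (Arm k l))"
proof (induction l)
  case 0
  then show ?case using reduces_with_Branch(2) by (simp add: reduces_with_sym)
next
  case (Suc l)
  let ?i = "Arm k l" and ?h = "Arm k (Suc l)"
  note S = subspace_reduces_with[of "sroot ?i"]
  have IH: "sroot (inward ?i) \<in> reduces_with (sroot ?i)" using Suc by simp
  have "inward ?i \<noteq> ?h" "adj a b c (inward ?i) ?i" "adj a b c ?i ?h"
    using Suc.prems by (cases l; simp)+
  then have "sroot (inward ?i) + sroot ?i + sroot ?h \<in> reduces_with (sroot ?i)"
    using Suc.prems by (intro reduces_with_elementary elementary_path) auto
  then have "sroot (inward ?i) + sroot ?i + sroot ?h - sroot (inward ?i) - sroot ?i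
      \<in> reduces_with (sroot ?i)"
    using IH reduces_with_self Suc.prems by (intro subspace_diff[OF S]) auto
  then have "sroot ?h \<in> reduces_with (sroot ?i)" by simp
  then show ?case by (simp add: reduces_with_sym)
qed

lemma reduces_with_sroot:
  assumes "i \<in> verts a b c" "j \<in> verts a b c"
  shows "sroot j \<in> reduces_with (sroot i)"
proof -
  have step: "sroot q \<in> reduces_with (sroot p)" if "p \<in> verts a b c" "towards p q" for p q
    using that reduces_with_inward by (cases p) (auto simp: towards_iff_inward)
  from assms show ?thesis
  proof (cases rule: cartan_cases)
    case 1
    then show ?thesis using assms by (intro reduces_with_elementary elementary_orth)
  next
    case 2
    then show ?thesis
      using assms reduces_with_Branch(1) reduces_with_self reduces_with_inward by (cases i) auto
  next
    case 3
    then show ?thesis using step assms by blast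
  next
    case 4
    then show ?thesis using step assms reduces_with_sym by blast
  qed
qed

text \<open>
  The relation is symmetric and linear in either argument, so it extends from pairs of simple
  roots to \<open>V\<close> one argument at a time.
\<close>

lemma refl_rep_subset_reduces_with:
  assumes "x \<in> refl_rep a b c"
  shows "refl_rep a b c \<subseteq> reduces_with x"
proof -
  have "refl_rep a b c \<subseteq> reduces_with (sroot i)" if "i \<in> verts a b c" for i
    unfolding refl_rep_def using that reduces_with_sroot
    by (intro span_minimal subspace_reduces_with) auto
  then have "x \<in> reduces_with (sroot i)" if "i \<in> verts a b c" for i
    using that assms by blast
  then show ?thesis
    unfolding refl_rep_def
    by (intro span_minimal subspace_reduces_with) (auto simp: reduces_with_sym[of _ x])
qed

lemma sym_square_mod_elementary_basis:
  assumes "t \<in> sym_square a b c"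
  shows "t - (Blin a b c t / 4) *\<^sub>R branch_square \<in> span (elementary_basis a b c)"
proof -
  let ?f = "\<lambda>t. t - (Blin a b c t / 4) *\<^sub>R branch_square"
  have "linear (\<lambda>t. (Blin a b c t / 4) *\<^sub>R branch_square)"
    by (rule linearI)
       (simp_all add: linear_add[OF linear_Blin] linear_scale[OF linear_Blin]
         add_divide_distrib scaleR_add_left)
  then have "linear ?f" by (rule linear_compose_sub[OF linear_ident])
  then have "subspace {t. ?f t \<in> span (elementary_basis a b c)}"
    by (rule linear_subspace_vimage[unfolded vimage_def, OF _ subspace_span])
  moreover have "?f (sym_tensor x y) \<in> span (elementary_basis a b c)"
    if "x \<in> refl_rep a b c" "y \<in> refl_rep a b c" for x y
    using refl_rep_subset_reduces_with[OF that(1)] that(2)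
    by (auto simp: reduces_with_def Blin_sym_tensor)
  ultimately have "sym_square a b c \<subseteq> {t. ?f t \<in> span (elementary_basis a b c)}"
    unfolding sym_square_def by (intro span_minimal) auto
  then show ?thesis using assms by blast
qed

lemma span_elementary_basis: "span (elementary_basis a b c) = kerB a b c"
proof
  show "span (elementary_basis a b c) \<subseteq> kerB a b c"
    by (rule span_minimal[OF elementary_basis_subset_kerB subspace_kerB])
  show "kerB a b c \<subseteq> span (elementary_basis a b c)"
  proof
    fix t assume "t \<in> kerB a b c"
    then show "t \<in> span (elementary_basis a b c)"
      using sym_square_mod_elementary_basis[of t] by (simp add: kerB_def)
  qed
qed


section \<open>The elementary tensors are independent\<close>

text \<open>
  A path through an inner vertex of an arm is assigned to its outer edge, and a path through the
  branch vertex to the one edge there that it avoids. This matches the path roots with the edges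
  of the tree, an edge being given by its outer end. The value at \<open>Branch\<close>, which is not the outer
  end of an edge, is arbitrary.
\<close>

fun outer_path_root :: "vertex \<Rightarrow> (vertex \<Rightarrow>\<^sub>0 real)" where
  "outer_path_root (Arm k 0) = sroot Branch + (\<Sum>k'\<in>UNIV - {k}. sroot (Arm k' 0))"
| "outer_path_root (Arm k (Suc l)) =
     sroot (inward (Arm k l)) + sroot (Arm k l) + sroot (Arm k (Suc l))"
| "outer_path_root Branch = 0"

text \<open>
  This indexes the elementary tensors by unordered pairs of vertices. The diagonal carries the
  tensors \<open>\<alpha>\<^sub>i \<or> \<theta>\<^sub>i\<close>, its free place at the branch vertex is filled with \<open>branch_square\<close>, and
  the edges carry the path roots.
\<close>

definition elementary_at :: "vertex \<Rightarrow> vertex \<Rightarrow> (vertex \<times> vertex \<Rightarrow>\<^sub>0 real)" where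
  "elementary_at i j =
    (if i = j then if i = Branch then branch_square else sym_tensor (sroot i) (theta a b c i)
     else if towards i j then sym_tensor (sroot j) (outer_path_root i)
     else if towards j i then sym_tensor (sroot i) (outer_path_root j)
     else sym_tensor (sroot i) (sroot j))"

lemma elementary_at_sym: "elementary_at i j = elementary_at j i"
  using not_towards_both[of i j]
  by (cases "i = j"; cases "towards i j"; cases "towards j i")
     (simp_all add: elementary_at_def sym_tensor_commute[of "sroot i" "sroot j"])

lemma path_eq_outer_path_root:
  assumes "h \<noteq> j" "adj a b c h i" "adj a b c i j"
  obtains p where "p \<in> verts a b c" "towards p i" "sroot h + sroot i + sroot j = outer_path_root p"
proof (cases i)
  case Branch
  then obtain k k' where k: "h = Arm k 0" "j = Arm k' 0" "k \<noteq> k'"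
    using assms by (cases h; cases j) auto
  obtain k'' where k'': "k'' \<noteq> k" "k'' \<noteq> k'" by (metis arm.distinct)
  then have "UNIV = {k, k', k''}"
    using k(3) by (cases k; cases k'; cases k''; simp add: UNIV_arm insert_commute)
  then have "UNIV - {k''} = {k, k'}" using k'' by blast
  with k Branch show ?thesis by (intro that[of "Arm k'' 0"]) (simp_all add: ac_simps)
next
  case (Arm k l)
  let ?p = "Arm k (Suc l)"
  have "h = inward (Arm k l) \<or> h = ?p"
    using assms(2) Arm by (cases l; cases h) auto
  moreover have "j = inward (Arm k l) \<or> j = ?p"
    using assms(3) Arm by (cases l; cases j) auto
  ultimately consider "h = inward (Arm k l)" "j = ?p" | "j = inward (Arm k l)" "h = ?p"
    using assms(1) by blast
  moreover have "?p \<in> verts a b c" if "h = ?p \<or> j = ?p"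
    using that assms(2,3) unfolding adj_def by blast
  ultimately show ?thesis
    using Arm by cases (rule that[of ?p]; simp add: ac_simps)+
qed

lemma elementary_basis_subset_elementary_at:
  "insert branch_square (elementary_basis a b c)
    \<subseteq> (\<lambda>(i, j). elementary_at i j) ` (verts a b c \<times> verts a b c)"
proof -
  have in_image: "elementary_at i j \<in> (\<lambda>(i, j). elementary_at i j) ` (verts a b c \<times> verts a b c)"
    if "i \<in> verts a b c" "j \<in> verts a b c" for i j
    using that by force
  have "\<exists>j\<in>verts a b c. sym_tensor (sroot i) \<beta> = elementary_at i j"
    if i: "i \<in> verts a b c" and el: "elementary a b c i \<beta>" for i \<beta>
  proof -
    consider j where "j \<in> verts a b c" "\<beta> = sroot j" "cartan a b c i j = 0"
      | h j where "h \<noteq> j" "adj a b c h i" "adj a b c i j" "\<beta> = sroot h + sroot i + sroot j"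
      | "i \<noteq> Branch" "\<beta> = theta a b c i"
      using el unfolding elementary_def by blast
    then show ?thesis
    proof cases
      case 1
      have "i \<noteq> j" using 1(3) by (auto simp: cartan_def)
      moreover have "\<not> adj a b c i j" using 1(3) cartan_adj[of a b c i j] by auto
      then have "\<not> towards i j" "\<not> towards j i" using i 1(1) by (simp_all add: adj_def)
      ultimately show ?thesis using 1(1,2) by (intro bexI[of _ j]) (simp_all add: elementary_at_def)
    next
      case 2
      obtain p where p: "p \<in> verts a b c" "towards p i"
        "sroot h + sroot i + sroot j = outer_path_root p"
        using path_eq_outer_path_root[OF 2(1-3)] .
      then show ?thesis
        using 2(4) not_towards_both[of p i]
        by (intro bexI[of _ p]) (auto simp: elementary_at_def)
    next
      case 3
      then show ?thesis using i by (intro bexI[of _ i]) (simp_all add: elementary_at_def)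
    qed
  qed
  then have "sym_tensor (sroot i) \<beta> \<in> (\<lambda>(i, j). elementary_at i j) ` (verts a b c \<times> verts a b c)"
    if "i \<in> verts a b c" "elementary a b c i \<beta>" for i \<beta>
    using that in_image by metis
  moreover have "branch_square = elementary_at Branch Branch" by (simp add: elementary_at_def)
  then have "branch_square \<in> (\<lambda>(i, j). elementary_at i j) ` (verts a b c \<times> verts a b c)"
    using in_image[of Branch Branch] by simp
  ultimately show ?thesis unfolding elementary_basis_def by blast
qed

text \<open>
  Including \<open>branch_square\<close> makes the two sides of the count equal: both families then span
  \<open>S\<^sup>2(V)\<close>, which has one dimension more than \<open>ker B\<close>.
\<close>

lemma independent_insert_branch_square:
  "independent (insert branch_square (elementary_basis a b c))"
proof -
  let ?V2 = "verts a b c \<times> verts a b c"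
  let ?T = "insert branch_square (elementary_basis a b c)"
  let ?P = "(\<lambda>(i, j). sym_tensor (sroot i) (sroot j)) ` ?V2"
  have fin: "finite ?V2" using finite_verts by simp
  have "finite ?T"
    by (rule finite_subset[OF elementary_basis_subset_elementary_at finite_imageI[OF fin]])
  moreover have "?P \<subseteq> span ?T"
  proof clarify
    fix i j assume "i \<in> verts a b c" "j \<in> verts a b c"
    then have "sym_tensor (sroot i) (sroot j)
        - (Bform a b c (sroot i) (sroot j) / 2) *\<^sub>R branch_square \<in> span (elementary_basis a b c)"
      using reduces_with_sroot by (simp add: reduces_with_def)
    then show "sym_tensor (sroot i) (sroot j) \<in> span ?T"
      by (auto simp: span_insert)
  qed
  moreover have "card ?T \<le> card ?P"
  proof -
    have "card ?T \<le> card ((\<lambda>(i, j). elementary_at i j) ` ?V2)"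
      using fin by (intro card_mono elementary_basis_subset_elementary_at) simp
    also have "\<dots> \<le> card ?P"
    proof (rule card_image_le_card_image[OF fin])
      fix x y :: "vertex \<times> vertex"
      assume eq: "(case x of (i, j) \<Rightarrow> sym_tensor (sroot i) (sroot j)) =
        (case y of (i, j) \<Rightarrow> sym_tensor (sroot i) (sroot j))"
      obtain i j k l where xy: "x = (i, j)" "y = (k, l)" by (cases x; cases y)
      have "(i = k \<and> j = l) \<or> (j = k \<and> i = l)"
        using eq unfolding xy prod.case sym_tensor_sroot_eq_iff .
      then show "(case x of (i, j) \<Rightarrow> elementary_at i j) = (case y of (i, j) \<Rightarrow> elementary_at i j)"
        unfolding xy prod.case using elementary_at_sym[of k l] by (elim disjE conjE) (simp_all only:)
    qed
    finally show ?thesis .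
  qed
  ultimately show ?thesis using independent_sym_tensor_sroot independent_if_card_le by blast
qed

end


section \<open>The basis theorem\<close>

theorem theorem1p8:
  fixes a b c :: nat
  assumes "a \<ge> 1" and "b \<ge> 1" and "c \<ge> 1"
  shows "independent (elementary_basis a b c) \<and> span (elementary_basis a b c) = kerB a b c"
proof -
  interpret Y_tree a b c by unfold_locales (fact assms)+
  show ?thesis
    using span_elementary_basis independent_mono[OF independent_insert_branch_square] by blast
qed

end
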